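(* For integers $d_1\ge 1$ and $d_2>2$, let $X_{d_1,d_2}$ be a random variable having the $F$-distribution with parameters $d_1$ and $d_2$, and let $E[X_{d_1,d_2}]$ be its expectation. Let $\kappa>0$ be a real number, and let the infima below be taken over all pairs of integers $(d_1,d_2)$ with $d_1\ge 1$ and $d_2>2$. Then: \begin{itemize} \item if $0<\kappa<1$, then $\inf_{d_1,d_2}P\left(X_{d_1,d_2}\le \kappa E[X_{d_1,d_2}]\right)=0$; \item if $\kappa=1$, then $\inf_{d_1,d_2}P\left(X_{d_1,d_2}\le \kappa E[X_{d_1,d_2}]\right)=\frac12$; \item if $\kappa>1$, then $\inf_{d_1,d_2}P\left(X_{d_1,d_2}\le \kappa E[X_{d_1,d_2}]\right)\ge\frac12$. \end{itemize} In particular, for all integers $d_1\ge 1$ and $d_2>2$, $$P\left(X_{d_1,d_2}\le E[X_{d_1,d_2}]\right)>\frac12,$$ and $$\inf_{d_1,d_2}P\left(X_{d_1,d_2}\le E[X_{d_1,d_2}]\right)=\frac12.$$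
   Context: For integers $d_1\ge1$ and $d_2>2$, an $F$-random variable $X_{d_1,d_2}$ with parameters $d_1,d_2$ is a positive random variable with distribution function $$P(X_{d_1,d_2}\le x)=I_{\frac{d_1x}{d_1x+d_2}}\left(\frac{d_1}{2},\frac{d_2}{2}\right),\quad x>0,$$ and its expectation is $E[X_{d_1,d_2}]=\frac{d_2}{d_2-2}$. Here $I_x(a,b)$ is the regularized incomplete beta function $$I_x(a,b)=\frac{\int_0^x t^{a-1}(1-t)^{b-1}\,dt}{B(a,b)},\qquad B(a,b)=\int_0^1 t^{a-1}(1-t)^{b-1}\,dt,$$ for $a,b>0$ and $x\in(0,1)$. *)

theory Defs
  imports "HOL-Probability.Probability"
begin

text \<open>The regularized incomplete beta function, meant for \<open>a, b > 0\<close> and \<open>0 < x < 1\<close>.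
  The library's \<^const>\<open>Beta\<close> is defined through \<^const>\<open>Gamma\<close>; lemma \<open>Beta_eq_integral\<close>
  identifies it with the usual integral.\<close>

definition inc_beta_reg :: "real \<Rightarrow> real \<Rightarrow> real \<Rightarrow> real" where
  "inc_beta_reg x a b =
     integral {0..x} (\<lambda>t. t powr (a - 1) * (1 - t) powr (b - 1)) / Beta a b"

lemma Beta_eq_integral:
  fixes a b :: real
  assumes "a > 0" "b > 0"
  shows "Beta a b = integral {0..1} (\<lambda>t. t powr (a - 1) * (1 - t) powr (b - 1))"
  using has_integral_Beta_real[OF assms] by (simp add: integral_unique)

text \<open>Positivity is only required almost surely, so that the predicate depends on nothing
  but the distribution of \<open>X\<close>.\<close>

definition F_random_variable :: "'a measure \<Rightarrow> int \<Rightarrow> int \<Rightarrow> ('a \<Rightarrow> real) \<Rightarrow> bool" where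
  "F_random_variable M d1 d2 X \<longleftrightarrow>
     prob_space M \<and> X \<in> borel_measurable M \<and> (AE \<omega> in M. 0 < X \<omega>) \<and>
     (\<forall>x>0. \<P>(\<omega> in M. X \<omega> \<le> x) =
        inc_beta_reg (real_of_int d1 * x / (real_of_int d1 * x + real_of_int d2))
          (real_of_int d1 / 2) (real_of_int d2 / 2))"

end

theory Submission
  imports Defs
begin

text \<open>
  Put \<open>a = d1 / 2\<close> and \<open>b = d2 / 2\<close>. If \<open>X\<close> is an \<open>F\<close>-variable, then \<open>Y = d1 X / (d1 X + d2)\<close> has the
  beta distribution with parameters \<open>a, b\<close>, and \<open>X\<close> is \<open>b / a\<close> times the odds \<open>Y / (1 - Y)\<close>. The odds
  have mean \<open>a / (b - 1)\<close>, so \<open>X\<close> has mean \<open>b / (b - 1)\<close>, and the probability in question is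
  \<open>I\<^sub>y(a, b)\<close> with \<open>y = a \<kappa> / (a \<kappa> + b - 1)\<close>
  (lemma \<open>F_random_variable_prob_le_mult_expectation\<close>).

  For \<open>\<kappa> = 1\<close> the threshold \<open>p = a / (a + b - 1)\<close> is the point at which \<open>t\<^sup>a (1 - t)\<^sup>b\<^sup>-\<^sup>1\<close>,
  the density of \<open>Y\<close> with respect to \<open>dt / t\<close>, is largest; in other words \<open>ln p\<close> is the mode of \<open>ln Y\<close>.
  The density of \<open>ln Y\<close> falls off more slowly to the left of its mode than to the right: its value at
  \<open>ln p - s\<close> exceeds the one at \<open>ln p + s\<close> for every \<open>s > 0\<close> (lemma \<open>beta_reflection_less\<close>, where
  the reflection \<open>s \<mapsto> -s\<close> reads \<open>v \<mapsto> p\<^sup>2 / v\<close>). Hence more than half of the mass lies below \<open>p\<close>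
  (lemma \<open>inc_beta_reg_mode_gt_half\<close>). This gives the strict inequality for \<open>\<kappa> = 1\<close>, and
  the bound for \<open>\<kappa> > 1\<close> by monotonicity.

  The values of the infima are approached along the diagonal \<open>a = b = m + 1\<close>, where the beta distribution is
  symmetric about \<open>1/2\<close> and concentrates there. For \<open>\<kappa> = 1\<close> the threshold exceeds \<open>1/2\<close> by
  only \<open>1 / (2 (2 m + 1))\<close>, while the density is \<open>O(\<surd>m)\<close>, so the probability tends to \<open>1/2\<close>; for
  \<open>\<kappa> < 1\<close> the threshold tends to \<open>\<kappa> / (1 + \<kappa>) < 1/2\<close>, and the probability decays exponentially.
\<close>

section \<open>The incomplete beta function\<close>


definition beta_kernel :: "real \<Rightarrow> real \<Rightarrow> real \<Rightarrow> real" where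
  "beta_kernel a b t = t powr (a - 1) * (1 - t) powr (b - 1)"

lemma beta_kernel_nonneg: "0 \<le> beta_kernel a b t"
  by (simp add: beta_kernel_def)

lemma borel_measurable_beta_kernel [measurable]: "beta_kernel a b \<in> borel_measurable borel"
  unfolding beta_kernel_def by measurable

lemma beta_kernel_has_integral:
  assumes "0 < a" "0 < b"
  shows "(beta_kernel a b has_integral Beta a b) {0..1}"
  using has_integral_Beta_real[OF assms] unfolding beta_kernel_def .

lemma beta_kernel_integrable:
  assumes "0 < a" "0 < b" "0 \<le> u" "v \<le> 1"
  shows "beta_kernel a b integrable_on {u..v}"
  by (rule integrable_on_subinterval[OF has_integral_integrable[OF beta_kernel_has_integral]])
    (use assms in auto)

lemma Beta_pos:
  fixes a b :: real
  assumes "0 < a" "0 < b"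
  shows "0 < Beta a b"
  using assms by (simp add: Beta_def Gamma_real_pos)

lemma inc_beta_reg_kernel: "inc_beta_reg x a b = integral {0..x} (beta_kernel a b) / Beta a b"
  by (simp add: inc_beta_reg_def beta_kernel_def[abs_def])

lemma inc_beta_reg_mono:
  assumes "0 < a" "0 < b" "0 \<le> x" "x \<le> y" "y \<le> 1"
  shows "inc_beta_reg x a b \<le> inc_beta_reg y a b"
proof -
  have "integral {0..x} (beta_kernel a b) \<le> integral {0..y} (beta_kernel a b)"
    using assms by (intro integral_subset_le beta_kernel_integrable) (auto simp: beta_kernel_nonneg)
  then show ?thesis
    unfolding inc_beta_reg_kernel using Beta_pos[OF assms(1,2)] by (simp add: divide_right_mono)
qed

text \<open>The threshold grows with \<open>\<kappa>\<close>, which reduces the case \<open>\<kappa> > 1\<close> to \<open>\<kappa> = 1\<close>.\<close>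

lemma inc_beta_reg_mono_threshold:
  assumes a: "0 < a" and b: "0 < b - 1" and k: "1 \<le> k"
  shows "inc_beta_reg (a / (a + b - 1)) a b \<le> inc_beta_reg (a * k / (a * k + b - 1)) a b"
proof (rule inc_beta_reg_mono)
  have pos: "0 < a + b - 1" "0 < a * k" using a b k by auto
  have "a * (b - 1) * 1 \<le> a * (b - 1) * k" using a b k by (intro mult_left_mono) auto
  then have "a * (a * k + b - 1) \<le> a * k * (a + b - 1)" by (simp add: algebra_simps)
  moreover have "0 < a * k + b - 1" using pos b by linarith
  ultimately show "a / (a + b - 1) \<le> a * k / (a * k + b - 1)"
    using pos by (simp only: pos_divide_le_eq pos_le_divide_eq times_divide_eq_left)
  show "a * k / (a * k + b - 1) \<le> 1" using pos b by simp
qed (use a b in auto)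

section \<open>The beta distribution\<close>

definition beta_density :: "real \<Rightarrow> real \<Rightarrow> real \<Rightarrow> real" where
  "beta_density a b t = indicator {0..1} t * (beta_kernel a b t / Beta a b)"

definition beta_measure :: "real \<Rightarrow> real \<Rightarrow> real measure" where
  "beta_measure a b = density lborel (\<lambda>t. ennreal (beta_density a b t))"

lemma borel_measurable_beta_density [measurable]: "beta_density a b \<in> borel_measurable borel"
  unfolding beta_density_def by measurable

lemma beta_density_nonneg:
  assumes "0 < a" "0 < b"
  shows "0 \<le> beta_density a b t"
  using Beta_pos[OF assms] by (simp add: beta_density_def beta_kernel_nonneg indicator_def)

lemma emeasure_beta_measure_atMost:
  assumes "0 < a" "0 < b" "0 \<le> y" "y \<le> 1"
  shows "emeasure (beta_measure a b) {..y} = ennreal (inc_beta_reg y a b)"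
proof -
  have *: "((\<lambda>t. beta_kernel a b t / Beta a b) has_integral inc_beta_reg y a b) {0..y}"
    unfolding inc_beta_reg_kernel
    using assms by (intro has_integral_divide integrable_integral beta_kernel_integrable) auto
  have "emeasure (beta_measure a b) {..y}
      = (\<integral>\<^sup>+t. ennreal (beta_density a b t) * indicator {..y} t \<partial>lborel)"
    unfolding beta_measure_def by (subst emeasure_density) auto
  also have "\<dots> = (\<integral>\<^sup>+t. ennreal (indicator {0..y} t * (beta_kernel a b t / Beta a b)) \<partial>lborel)"
    using assms by (intro nn_integral_cong) (auto simp: beta_density_def indicator_def)
  also have "\<dots> = ennreal (inc_beta_reg y a b)"
    using * Beta_pos[OF assms(1,2)] beta_kernel_nonneg
    by (intro nn_integral_has_integral_lebesgue) auto
  finally show ?thesis .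
qed

lemma inc_beta_reg_1:
  assumes "0 < a" "0 < b"
  shows "inc_beta_reg 1 a b = 1"
  unfolding inc_beta_reg_kernel integral_unique[OF beta_kernel_has_integral[OF assms]]
  using Beta_pos[OF assms] by simp

lemma beta_measure_real_distribution:
  assumes "0 < a" "0 < b"
  shows "real_distribution (beta_measure a b)"
proof -
  have "emeasure (beta_measure a b) UNIV = (\<integral>\<^sup>+t. ennreal (beta_density a b t) \<partial>lborel)"
    unfolding beta_measure_def by (subst emeasure_density) auto
  also have "\<dots> = ennreal 1"
    unfolding beta_density_def
    using has_integral_divide[OF beta_kernel_has_integral[OF assms], of "Beta a b"]
      Beta_pos[OF assms] beta_kernel_nonneg
    by (intro nn_integral_has_integral_lebesgue) auto
  finally have "prob_space (beta_measure a b)"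
    by (intro prob_spaceI) (simp add: beta_measure_def)
  then show ?thesis
    by (simp add: real_distribution_def real_distribution_axioms_def beta_measure_def)
qed

lemma cdf_beta_measure:
  assumes "0 < a" "0 < b"
  shows "cdf (beta_measure a b) y =
    (if y \<le> 0 then 0 else if y < 1 then inc_beta_reg y a b else 1)"
proof -
  interpret real_distribution "beta_measure a b"
    by (rule beta_measure_real_distribution[OF assms])
  have mid: "cdf (beta_measure a b) y = inc_beta_reg y a b" if "0 \<le> y" "y \<le> 1" for y
  proof -
    have "0 \<le> inc_beta_reg y a b"
      using inc_beta_reg_mono[OF assms order_refl that] by (simp add: inc_beta_reg_kernel)
    then show ?thesis
      using emeasure_beta_measure_atMost[OF assms that] by (simp add: cdf_def2 measure_def)
  qed
  have "cdf (beta_measure a b) y \<le> cdf (beta_measure a b) 0" if "y \<le> 0"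
    by (rule cdf_nondecreasing[OF that])
  moreover have "cdf (beta_measure a b) 0 = 0"
    using mid[of 0] by (simp add: inc_beta_reg_kernel)
  moreover have "cdf (beta_measure a b) 1 \<le> cdf (beta_measure a b) y" if "1 \<le> y"
    by (rule cdf_nondecreasing[OF that])
  moreover have "cdf (beta_measure a b) 1 = 1"
    using mid[of 1] inc_beta_reg_1[OF assms] by simp
  ultimately show ?thesis
    using mid[of y] cdf_nonneg[of y] cdf_bounded_prob[of y]
    by (smt (verit) )
qed

text \<open>Multiplying the beta kernel by the odds shifts its parameters to \<open>a + 1, b - 1\<close>, so the
  mean is a quotient of two beta functions. The condition \<open>b > 1\<close> keeps the second parameter
  positive, that is, it makes the mean finite.\<close>

lemma beta_measure_odds_integral:
  assumes "0 < a" "1 < b"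
  shows "(\<integral>t. t / (1 - t) \<partial>beta_measure a b) = a / (b - 1)"
proof -
  have ab: "0 < a" "0 < b" using assms by auto
  have *: "((\<lambda>t. beta_kernel (a + 1) (b - 1) t / Beta a b)
      has_integral Beta (a + 1) (b - 1) / Beta a b) {0..1}"
    using assms by (intro has_integral_divide beta_kernel_has_integral) auto
  \<comment> \<open>At the end points both sides vanish, because \<open>t / 0 = 0\<close> and \<open>0 powr c = 0\<close>.\<close>
  have eq: "beta_density a b t * (t / (1 - t))
      = indicator {0..1} t * (beta_kernel (a + 1) (b - 1) t / Beta a b)" for t
  proof (cases "0 < t \<and> t < 1")
    case True
    then have "t powr (a - 1) * t = t powr a" "(1 - t) powr (b - 1) / (1 - t) = (1 - t) powr (b - 2)"
      by (simp_all add: powr_diff powr_minus_divide power2_eq_square)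
    then have "beta_kernel a b t * (t / (1 - t)) = beta_kernel (a + 1) (b - 1) t"
      unfolding beta_kernel_def by (metis (no_types, lifting) add_diff_cancel_right' diff_diff_eq mult.assoc mult.commute one_add_one times_divide_eq_right)
    then show ?thesis
      unfolding beta_density_def by (metis times_divide_eq_left mult.assoc)
  next
    case False
    then show ?thesis
      by (auto simp: beta_density_def beta_kernel_def indicator_def)
  qed
  have "(\<integral>t. t / (1 - t) \<partial>beta_measure a b)
      = (\<integral>t. indicator {0..1} t * (beta_kernel (a + 1) (b - 1) t / Beta a b) \<partial>lborel)"
    unfolding beta_measure_def using beta_density_nonneg[OF ab]
    by (subst integral_density) (auto simp: eq[simplified])
  also have "\<dots> = enn2real (ennreal (Beta (a + 1) (b - 1) / Beta a b))"
    using Beta_pos[OF ab] beta_kernel_nonneg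
    by (subst integral_eq_nn_integral, measurable,
        subst nn_integral_has_integral_lebesgue[OF _ *]) (auto simp: indicator_def)
  also have "\<dots> = Beta (a + 1) (b - 1) / Beta a b"
    using Beta_pos[of a b] Beta_pos[of "a + 1" "b - 1"] assms by simp
  also have "\<dots> = a / (b - 1)"
  proof -
    have "a \<notin> \<int>\<^sub>\<le>\<^sub>0" "b - 1 \<notin> \<int>\<^sub>\<le>\<^sub>0"
      using assms by (auto simp: nonpos_Ints_def)
    then have "Gamma (a + 1) = a * Gamma a" "Gamma b = (b - 1) * Gamma (b - 1)"
      using Gamma_plus1[of a] Gamma_plus1[of "b - 1"] by auto
    then have "Beta (a + 1) (b - 1) * (b - 1) = a * Beta a b"
      by (simp add: Beta_def)
    then show ?thesis
      using assms Beta_pos[OF ab] by (simp add: field_simps)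
  qed
  finally show ?thesis .
qed

section \<open>The mean of an F-variable\<close>

text \<open>The map \<open>x \<mapsto> d1 x / (d1 x + d2)\<close> is increasing from \<open>(0, \<infinity>)\<close> onto \<open>(0, 1)\<close>, so the
  hypothesis on the distribution function of \<open>X\<close> determines the one of the image, and a law on
  the line is determined by its distribution function.\<close>

lemma F_random_variable_distr_beta:
  assumes F: "F_random_variable M d1 d2 X" and d: "1 \<le> d1" "2 < d2"
  shows "distr M borel (\<lambda>\<omega>. d1 * X \<omega> / (d1 * X \<omega> + d2)) = beta_measure (d1 / 2) (d2 / 2)"
    (is "distr M borel ?Y = _")
proof (rule cdf_unique)
  interpret prob_space M
    using F by (simp add: F_random_variable_def)
  have X [measurable]: "X \<in> borel_measurable M" and pos: "AE \<omega> in M. 0 < X \<omega>"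
    and cdfX: "\<And>x. 0 < x \<Longrightarrow> \<P>(\<omega> in M. X \<omega> \<le> x) =
        inc_beta_reg (real_of_int d1 * x / (real_of_int d1 * x + real_of_int d2))
          (real_of_int d1 / 2) (real_of_int d2 / 2)"
    using F by (auto simp: F_random_variable_def)
  have dpos: "0 < real_of_int d1" "0 < real_of_int d2"
    using d by auto
  show "real_distribution (distr M borel ?Y)"
    by (rule real_distribution_distr) measurable
  show "real_distribution (beta_measure (d1 / 2) (d2 / 2))"
    using dpos by (intro beta_measure_real_distribution) auto
  show "cdf (distr M borel ?Y) = cdf (beta_measure (d1 / 2) (d2 / 2))"
  proof
    fix y :: real
    have "cdf (distr M borel ?Y) y = \<P>(\<omega> in M. ?Y \<omega> \<le> y)"
      unfolding cdf_def2 by (subst measure_distr) (auto intro!: arg_cong[where f = "measure M"])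
    also have "\<dots> = (if y \<le> 0 then 0 else if y < 1 then inc_beta_reg y (d1 / 2) (d2 / 2) else 1)"
    proof -
      consider "y \<le> 0" | "0 < y" "y < 1" | "1 \<le> y" by linarith
      then show ?thesis
      proof cases
        case 1
        have "AE \<omega> in M. \<not> ?Y \<omega> \<le> y"
          using pos
        proof eventually_elim
          case (elim \<omega>)
          have "0 < ?Y \<omega>" using elim dpos by (intro divide_pos_pos add_pos_pos mult_pos_pos) auto
          with 1 show ?case by linarith
        qed
        then have "\<P>(\<omega> in M. ?Y \<omega> \<le> y) = 0"
          by (subst prob_eq_0) auto
        then show ?thesis using 1 by simp
      next
        case 2
        \<comment> \<open>the preimage of \<open>y\<close> under \<open>x \<mapsto> d1 x / (d1 x + d2)\<close>\<close>
        define x where "x = d2 * y / (d1 * (1 - y))"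
        have "0 < x" using 2 dpos by (simp add: x_def)
        have "AE \<omega> in M. ?Y \<omega> \<le> y \<longleftrightarrow> X \<omega> \<le> x"
          using pos
        proof eventually_elim
          case (elim \<omega>)
          have "0 < d1 * X \<omega> + d2" using elim dpos by (intro add_pos_pos mult_pos_pos) auto
          moreover have "0 < d1 * (1 - y)" using 2 dpos by simp
          ultimately show ?case
            by (simp add: x_def pos_divide_le_eq pos_le_divide_eq algebra_simps)
        qed
        then have "\<P>(\<omega> in M. ?Y \<omega> \<le> y) = \<P>(\<omega> in M. X \<omega> \<le> x)"
          by (intro finite_measure_eq_AE) auto
        also have "real_of_int d1 * x / (real_of_int d1 * x + real_of_int d2) = y"
        proof -
          have *: "real_of_int d1 * x = d2 * y / (1 - y)" using dpos by (simp add: x_def)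
          have "real_of_int d1 * x + real_of_int d2 = d2 / (1 - y)"
            unfolding * using 2 by (simp add: divide_simps) (simp add: algebra_simps)
          then show ?thesis using * dpos 2 by simp
        qed
        then have "\<P>(\<omega> in M. X \<omega> \<le> x) = inc_beta_reg y (d1 / 2) (d2 / 2)"
          using cdfX[OF \<open>0 < x\<close>] by simp
        finally show ?thesis using 2 by simp
      next
        case 3
        have "AE \<omega> in M. ?Y \<omega> \<le> y"
          using pos
        proof eventually_elim
          case (elim \<omega>)
          have "0 < d1 * X \<omega> + d2" using elim dpos by (intro add_pos_pos mult_pos_pos) auto
          then have "?Y \<omega> \<le> 1" using dpos by simp
          with 3 show ?case by linarith
        qed
        then have "\<P>(\<omega> in M. ?Y \<omega> \<le> y) = 1"
          by (subst prob_eq_1) auto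
        then show ?thesis using 3 by simp
      qed
    qed
    also have "\<dots> = cdf (beta_measure (d1 / 2) (d2 / 2)) y"
      using dpos by (subst cdf_beta_measure) auto
    finally show "cdf (distr M borel ?Y) y = cdf (beta_measure (d1 / 2) (d2 / 2)) y" .
  qed
qed

lemma F_random_variable_expectation:
  assumes F: "F_random_variable M d1 d2 X" and d: "1 \<le> d1" "2 < d2"
  shows "prob_space.expectation M X = d2 / (real_of_int d2 - 2)"
proof -
  interpret prob_space M
    using F by (simp add: F_random_variable_def)
  have X [measurable]: "X \<in> borel_measurable M" and pos: "AE \<omega> in M. 0 < X \<omega>"
    using F by (auto simp: F_random_variable_def)
  let ?Y = "\<lambda>\<omega>. d1 * X \<omega> / (d1 * X \<omega> + d2)"
  have dpos: "0 < real_of_int d1" "2 < real_of_int d2"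
    using d by auto
  have "AE \<omega> in M. X \<omega> = d2 / d1 * (?Y \<omega> / (1 - ?Y \<omega>))"
    using pos
  proof eventually_elim
    case (elim \<omega>)
    have "0 < d1 * X \<omega> + d2" using elim dpos by (intro add_pos_pos mult_pos_pos) auto
    then have "1 - ?Y \<omega> = d2 / (d1 * X \<omega> + d2)" by (simp add: field_simps)
    then show ?case using dpos \<open>0 < d1 * X \<omega> + d2\<close> by simp
  qed
  then have "expectation X = (\<integral>\<omega>. d2 / d1 * (?Y \<omega> / (1 - ?Y \<omega>)) \<partial>M)"
    by (intro integral_cong_AE) auto
  also have "\<dots> = d2 / d1 * (\<integral>\<omega>. ?Y \<omega> / (1 - ?Y \<omega>) \<partial>M)"
    by (rule integral_mult_right_zero)
  also have "(\<integral>\<omega>. ?Y \<omega> / (1 - ?Y \<omega>) \<partial>M) = (\<integral>t. t / (1 - t) \<partial>distr M borel ?Y)"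
    by (subst integral_distr) auto
  also have "\<dots> = (d1 / 2) / (d2 / 2 - 1)"
    unfolding F_random_variable_distr_beta[OF F d]
    using dpos by (intro beta_measure_odds_integral) auto
  also have "d2 / d1 * ((d1 / 2) / (d2 / 2 - 1)) = d2 / (real_of_int d2 - 2)"
    using dpos by (simp add: field_simps)
  finally show ?thesis by simp
qed

lemma F_random_variable_prob_le_mult_expectation:
  assumes F: "F_random_variable M d1 d2 X" and d: "1 \<le> d1" "2 < d2" and k: "0 < \<kappa>"
    and a: "a = d1 / 2" and b: "b = d2 / 2"
  shows "\<P>(\<omega> in M. X \<omega> \<le> \<kappa> * prob_space.expectation M X)
    = inc_beta_reg (a * \<kappa> / (a * \<kappa> + b - 1)) a b"
proof -
  have ab: "0 < a" "1 < b" using d a b by auto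
  have d12: "real_of_int d1 = 2 * a" "real_of_int d2 = 2 * b" using a b by auto
  moreover have E: "prob_space.expectation M X = b / (b - 1)"
    using F_random_variable_expectation[OF F d] ab unfolding d12 by (simp add: field_simps)
  moreover have "0 < \<kappa> * (b / (b - 1))" using k ab by simp
  ultimately have "\<P>(\<omega> in M. X \<omega> \<le> \<kappa> * prob_space.expectation M X)
    = inc_beta_reg (2 * a * (\<kappa> * (b / (b - 1))) / (2 * a * (\<kappa> * (b / (b - 1))) + 2 * b)) a b"
    using F unfolding F_random_variable_def by simp
  also have "2 * a * (\<kappa> * (b / (b - 1))) / (2 * a * (\<kappa> * (b / (b - 1))) + 2 * b)
    = a * \<kappa> / (a * \<kappa> + b - 1)"
  proof -
    have "2 * a * (\<kappa> * (b / (b - 1))) = (2 * b / (b - 1)) * (a * \<kappa>)" by simp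
    moreover have "2 * a * (\<kappa> * (b / (b - 1))) + 2 * b = (2 * b / (b - 1)) * (a * \<kappa> + b - 1)"
      using ab by (simp add: field_simps)
    moreover have "2 * b / (b - 1) \<noteq> 0" using ab by simp
    ultimately show ?thesis by (simp only: mult_divide_mult_cancel_left if_False simp_thms)
  qed
  finally show ?thesis .
qed



section \<open>More than half of the mass lies below the mean\<close>

text \<open>Up to the factor \<open>b - 1\<close>, the logarithm of the quotient of the two sides is the
  function \<open>K\<close> of the proof, which vanishes at \<open>p\<close>. With \<open>w = p\<^sup>2 / x\<close>, the claim \<open>K' < 0\<close> amounts to
  \<open>2 p / (1 - p) < x / (1 - x) + w / (1 - w)\<close>, which expresses that \<open>u / (1 - u)\<close> is strictly convex
  as a function of \<open>ln u\<close>, since \<open>p\<close> is the geometric mean of \<open>x\<close> and \<open>w\<close>.\<close>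

lemma beta_reflection_less:
  fixes p v a b :: real
  assumes p: "0 < p" "p < 1" and b: "1 < b" and mode: "a * (1 - p) = (b - 1) * p"
    and v: "p\<^sup>2 < v" "v < p"
  shows "(p\<^sup>2 / v) powr a * (1 - p\<^sup>2 / v) powr (b - 1) < v powr a * (1 - v) powr (b - 1)"
proof -
  have v0: "0 < v" using v(1) zero_le_power2[of p] by linarith
  define K where "K = (\<lambda>x. 2 * p / (1 - p) * (ln x - ln p) + ln (1 - x) - ln (1 - p\<^sup>2 / x))"
  have rng: "0 < x \<and> x < 1 \<and> p\<^sup>2 / x < 1" if "v \<le> x" "x \<le> p" for x
    using that v v0 p by (auto simp: divide_less_eq)
  have "K p < K v"
  proof (rule DERIV_neg_imp_decreasing_open[OF v(2)])
    fix x assume x: "v < x" "x < p"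
    then have r: "0 < x" "x < 1" "p\<^sup>2 / x < 1" using rng[of x] by auto
    define w where "w = p\<^sup>2 / x"
    have w: "0 < w" "w < 1" "x * w = p\<^sup>2" using r p by (auto simp: w_def)
    define D where "D = (2 * p / (1 - p) - x / (1 - x) - w / (1 - w)) / x"
    have "(K has_real_derivative D) (at x)"
    proof -
      have "(K has_real_derivative
          2 * p / (1 - p) * (1 / x) + (- 1) / (1 - x) - (p\<^sup>2 / (x * x)) / (1 - p\<^sup>2 / x)) (at x)"
      proof -
        have "((\<lambda>x. p\<^sup>2 / x) has_real_derivative - (p\<^sup>2 / (x * x))) (at x)"
          using r by (auto intro!: derivative_eq_intros)
        then have "((\<lambda>x. ln (1 - p\<^sup>2 / x)) has_real_derivative 1 / (1 - p\<^sup>2 / x) * (p\<^sup>2 / (x * x))) (at x)"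
          using r by (intro DERIV_chain2[where f = ln] DERIV_ln_divide) (auto intro!: DERIV_cong[OF DERIV_diff[OF DERIV_const]])
        moreover have "((\<lambda>x. 2 * p / (1 - p) * (ln x - ln p) + ln (1 - x)) has_real_derivative
            2 * p / (1 - p) * (1 / x) + (- 1) / (1 - x)) (at x)"
          using r by (auto intro!: derivative_eq_intros)
        ultimately show ?thesis
          unfolding K_def by (auto intro!: DERIV_cong[OF DERIV_diff])
      qed
      also have "2 * p / (1 - p) * (1 / x) + (- 1) / (1 - x) - (p\<^sup>2 / (x * x)) / (1 - p\<^sup>2 / x) = D"
      proof -
        have "p\<^sup>2 / (x * x) = w / x" by (simp add: w_def)
        moreover have "p\<^sup>2 / x = w" by (simp add: w_def)
        ultimately show ?thesis
          unfolding D_def using r by (simp add: diff_divide_distrib)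
      qed
      finally show ?thesis .
    qed
    moreover have "D < 0"
    proof -
      have "x < w"
      proof (rule ccontr)
        assume "\<not> x < w"
        then have "x * w \<le> x * x" using r by simp
        moreover have "x * x < p\<^sup>2"
          using x r p by (simp add: power2_eq_square mult_strict_mono)
        ultimately show False using w(3) by simp
      qed
      then have "0 < (x - w)\<^sup>2" by simp
      then have "(2 * p)\<^sup>2 < (x + w)\<^sup>2" using w(3) by (simp add: power2_eq_square algebra_simps)
      then have s: "2 * p < x + w"
        by (rule power2_less_imp_less) (use r w in simp)
      \<comment> \<open>With \<open>x w = p\<^sup>2\<close>, clearing denominators leaves only the sum \<open>x + w\<close>.\<close>
      have "(x * (1 - w) + w * (1 - x)) * (1 - p) - 2 * p * ((1 - x) * (1 - w))
          = (x + w - 2 * (x * w)) * (1 - p) - 2 * p * (1 - (x + w) + x * w)"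
        by (simp add: algebra_simps)
      also have "\<dots> = (1 + p) * ((x + w) - 2 * p)"
        unfolding w(3) by (simp add: power2_eq_square algebra_simps)
      finally have "2 * p * ((1 - x) * (1 - w)) < (x * (1 - w) + w * (1 - x)) * (1 - p)"
        using mult_pos_pos[of "1 + p" "(x + w) - 2 * p"] s p by linarith
      moreover have "0 < (1 - x) * (1 - w)" using r w by simp
      ultimately have "2 * p / (1 - p) < (x * (1 - w) + w * (1 - x)) / ((1 - x) * (1 - w))"
        using p by (simp only: pos_divide_less_eq pos_less_divide_eq diff_gt_0_iff_gt times_divide_eq_left)
      also have "\<dots> = x / (1 - x) + w / (1 - w)"
        using r w by (intro add_frac_eq[symmetric]) auto
      finally show ?thesis unfolding D_def using r by (intro divide_neg_pos) auto
    qed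
    ultimately show "\<exists>y. (K has_real_derivative y) (at x) \<and> y < 0" by blast
  next
    show "continuous_on {v..p} K"
      unfolding K_def using v v0 p by (auto intro!: continuous_intros)
  qed
  moreover have "K p = 0" using p by (simp add: K_def power2_eq_square)
  ultimately have "0 < K v" by simp
  then have "0 < (b - 1) * K v" using b by simp
  also have "(b - 1) * K v = 2 * a * (ln v - ln p) + (b - 1) * (ln (1 - v) - ln (1 - p\<^sup>2 / v))"
  proof -
    have "(b - 1) * (2 * p / (1 - p)) = 2 * a" using mode p by (simp add: field_simps)
    then show ?thesis
      unfolding K_def by (simp only: add_diff_eq[symmetric] distrib_left mult.assoc[symmetric])
  qed
  finally have "a * (2 * ln p - ln v) + (b - 1) * ln (1 - p\<^sup>2 / v) < a * ln v + (b - 1) * ln (1 - v)"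
    by (simp add: algebra_simps)
  then have "exp (a * ln (p\<^sup>2 / v)) * exp ((b - 1) * ln (1 - p\<^sup>2 / v))
      < exp (a * ln v) * exp ((b - 1) * ln (1 - v))"
    using p v0 by (simp add: exp_add[symmetric] ln_div ln_realpow)
  then show ?thesis
    using rng[of v] v v0 p by (simp add: powr_def)
qed

text \<open>The substitution \<open>t = p\<^sup>2 / v\<close> turns the mass above \<open>p\<close> into an integral over \<open>(p\<^sup>2, p)\<close>
  whose integrand is smaller than the beta kernel there. The proof carries this out on
  antiderivatives: \<open>S x\<close> is the integral over \<open>(p\<^sup>2, x)\<close> plus the one over \<open>(p\<^sup>2, p\<^sup>2 / x)\<close>; it grows
  from \<open>x = p\<^sup>2\<close> to \<open>x = p\<close>, and its values at these points are the mass of \<open>(p\<^sup>2, 1)\<close> and twice the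
  mass of \<open>(p\<^sup>2, p)\<close>.\<close>

lemma inc_beta_reg_mode_gt_half:
  fixes a b :: real
  assumes a: "0 < a" and b: "1 < b"
  shows "1 / 2 < inc_beta_reg (a / (a + b - 1)) a b"
proof -
  define p where "p = a / (a + b - 1)"
  have p: "0 < p" "p < 1" using a b by (auto simp: p_def)
  have mode: "a * (1 - p) = (b - 1) * p" using a b by (simp add: p_def field_simps)
  have p2: "0 < p\<^sup>2" "p\<^sup>2 < p" using p by (auto simp: power2_eq_square)
  let ?k = "beta_kernel a b"
  \<comment> \<open>Starting at \<open>p\<^sup>2\<close> avoids the singularity of the kernel at \<open>0\<close> for \<open>a < 1\<close>; \<open>b > 1\<close> makes
    it continuous at \<open>1\<close>.\<close>
  have cont: "continuous_on {p\<^sup>2..1} ?k"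
    unfolding beta_kernel_def using p2 b by (auto intro!: continuous_intros continuous_on_powr' intro: order_trans[of 0 "p\<^sup>2"])
  define H where "H = (\<lambda>x. integral {p\<^sup>2..x} ?k)"
  have Hcont: "continuous_on {p\<^sup>2..1} H"
    unfolding H_def by (intro indefinite_integral_continuous_1 integrable_continuous_real cont)
  have Hder: "(H has_real_derivative ?k x) (at x)" if "p\<^sup>2 < x" "x < 1" for x
  proof -
    have "(H has_real_derivative ?k x) (at x within {p\<^sup>2..1})"
      unfolding H_def using that by (intro integral_has_real_derivative cont) auto
    moreover have "at x within {p\<^sup>2..1} = at x"
      using that by (intro at_within_interior) auto
    ultimately show ?thesis by simp
  qed
  have refl: "p \<le> p\<^sup>2 / x \<and> p\<^sup>2 / x \<le> 1 \<and> 0 < x" if "p\<^sup>2 \<le> x" "x \<le> p" for x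
  proof -
    have "0 < x" using that p2 by linarith
    then show ?thesis using that p by (simp add: field_simps power2_eq_square)
  qed
  define S where "S = (\<lambda>x. H x + H (p\<^sup>2 / x))"
  have "S (p\<^sup>2) < S p"
  proof (rule DERIV_pos_imp_increasing_open[OF p2(2)])
    fix x assume x: "p\<^sup>2 < x" "x < p"
    have x0: "0 < x" using x p2 by linarith
    have "p\<^sup>2 * x < p\<^sup>2" using x p p2 by simp
    then have w: "p\<^sup>2 < p\<^sup>2 / x" "p\<^sup>2 / x < 1"
      using x x0 by (simp_all only: pos_less_divide_eq pos_divide_less_eq mult_1)
    have "(S has_real_derivative ?k x + ?k (p\<^sup>2 / x) * (- (p\<^sup>2) / (x * x))) (at x)"
      unfolding S_def using x x0 p
      by (intro DERIV_add Hder DERIV_chain2[where f = H] w)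
        (auto intro!: derivative_eq_intros)
    moreover have "0 < ?k x + ?k (p\<^sup>2 / x) * (- (p\<^sup>2) / (x * x))"
    proof -
      have pw: "?k t * t = t powr a * (1 - t) powr (b - 1)" if "0 < t" for t
        using that by (simp add: beta_kernel_def powr_diff)
      have "?k (p\<^sup>2 / x) * (p\<^sup>2 / x) < ?k x * x"
        using beta_reflection_less[OF p b mode x] x0 p2 by (simp only: pw divide_pos_pos)
      then have "?k (p\<^sup>2 / x) * (p\<^sup>2 / x) / x < ?k x"
        using x0 by (simp add: pos_divide_less_eq)
      then show ?thesis by simp
    qed
    ultimately show "\<exists>y. (S has_real_derivative y) (at x) \<and> 0 < y" by blast
  next
    have "continuous_on {p\<^sup>2..p} (\<lambda>x. H (p\<^sup>2 / x))"
    proof (rule continuous_on_compose2[OF Hcont])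
      show "continuous_on {p\<^sup>2..p} (\<lambda>x. p\<^sup>2 / x)"
        using p2 by (intro continuous_intros) auto
      show "(\<lambda>x. p\<^sup>2 / x) ` {p\<^sup>2..p} \<subseteq> {p\<^sup>2..1}"
      proof (rule image_subsetI)
        fix x assume "x \<in> {p\<^sup>2..p}"
        then show "p\<^sup>2 / x \<in> {p\<^sup>2..1}" using refl[of x] p2 unfolding atLeastAtMost_iff by linarith
      qed
    qed
    moreover have "continuous_on {p\<^sup>2..p} H"
      using p by (intro continuous_on_subset[OF Hcont]) auto
    ultimately show "continuous_on {p\<^sup>2..p} S"
      unfolding S_def by (intro continuous_on_add)
  qed
  then have less: "H 1 < 2 * H p"
    using p p2 by (simp add: S_def H_def power2_eq_square)
  have comb: "integral {0..x} ?k = integral {0..p\<^sup>2} ?k + H x" if "p\<^sup>2 \<le> x" "x \<le> 1" for x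
    unfolding H_def using that a b p2
    by (intro Henstock_Kurzweil_Integration.integral_combine[symmetric] beta_kernel_integrable) auto
  have "0 \<le> integral {0..p\<^sup>2} ?k"
    using beta_kernel_nonneg by (intro integral_nonneg beta_kernel_integrable) (use a b p2 p in auto)
  moreover have "integral {0..1} ?k = Beta a b"
    using a b by (intro integral_unique beta_kernel_has_integral) auto
  ultimately have "Beta a b < 2 * integral {0..p} ?k"
    using comb[of p] comb[of 1] less p p2 by simp
  then show ?thesis
    using Beta_pos[of a b] a b by (simp add: inc_beta_reg_kernel p_def field_simps)
qed

section \<open>Concentration for equal degrees of freedom\<close>

lemma inc_beta_reg_half:
  assumes "0 < a"
  shows "inc_beta_reg (1 / 2) a a = 1 / 2"
proof -
  let ?k = "beta_kernel a a"
  have "(?k has_integral integral {0..1/2} ?k) (cbox 0 (1/2))"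
    using assms beta_kernel_integrable[of a a 0 "1/2"] by (simp add: has_integral_integral)
  from has_integral_affinity[OF this, of "-1" 1]
  have "((\<lambda>x. ?k (1 - x)) has_integral integral {0..1/2} ?k) ((\<lambda>x. 1 - x) ` {0..1/2})"
    by simp
  moreover have "(\<lambda>x. 1 - x) ` {0..1/2} = {1/2..1::real}"
  proof -
    have "x \<in> (\<lambda>x. 1 - x) ` {0..1/2}" if "x \<in> {1/2..1}" for x :: real
      using that by (intro image_eqI[of _ _ "1 - x"]) auto
    then show ?thesis by auto
  qed
  moreover have "(\<lambda>x. ?k (1 - x)) = ?k"
    by (auto simp: beta_kernel_def mult.commute)
  ultimately have "integral {1/2..1} ?k = integral {0..1/2} ?k"
    by (simp add: integral_unique)
  moreover have "integral {0..1/2} ?k + integral {1/2..1} ?k = integral {0..1} ?k"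
    using assms
    by (intro Henstock_Kurzweil_Integration.integral_combine beta_kernel_integrable) auto
  moreover have "integral {0..1} ?k = Beta a a"
    using assms by (intro integral_unique beta_kernel_has_integral)
  ultimately show ?thesis
    using Beta_pos[OF assms assms] by (simp add: inc_beta_reg_kernel field_simps)
qed

text \<open>The probability \<open>(2m choose m) / 4\<^sup>m\<close> of as many heads as tails in \<open>2 m\<close> tosses of a fair coin. It
  governs the peak of the symmetric beta density: at \<open>1/2\<close> the density with parameters \<open>m + 1, m + 1\<close>
  is \<open>2 m + 1\<close> times this number (lemma \<open>Beta_Suc_Suc\<close>).\<close>

definition central_binomial_prob :: "nat \<Rightarrow> real" where
  "central_binomial_prob m = fact (2 * m) / (4 ^ m * (fact m)\<^sup>2)"

lemma central_binomial_prob_nonneg: "0 \<le> central_binomial_prob m"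
  by (simp add: central_binomial_prob_def)

text \<open>The bound is preserved in the induction because \<open>(2 m + 1) (2 m + 3) \<le> (2 m + 2)\<^sup>2\<close>.\<close>

lemma central_binomial_prob_sq_le: "(central_binomial_prob m)\<^sup>2 \<le> 1 / (2 * real m + 1)"
proof (induction m)
  case 0
  show ?case by (simp add: central_binomial_prob_def)
next
  case (Suc m)
  let ?r = "(2 * real m + 1) / (2 * real m + 2)"
  have "central_binomial_prob (Suc m) = central_binomial_prob m * ?r"
  proof -
    have "fact (2 * Suc m) = (2 * real m + 2) * (2 * real m + 1) * fact (2 * m)"
      by (simp add: algebra_simps)
    moreover have "4 ^ Suc m * (fact (Suc m))\<^sup>2 = (2 * real m + 2) * (2 * real m + 2) * (4 ^ m * (fact m)\<^sup>2)"
      by (simp add: power2_eq_square algebra_simps)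
    ultimately show ?thesis
      unfolding central_binomial_prob_def
      by (simp only:) (simp add: divide_simps)
  qed
  then have "(central_binomial_prob (Suc m))\<^sup>2 = (central_binomial_prob m)\<^sup>2 * ?r\<^sup>2"
    by (simp only: power_mult_distrib)
  also have "\<dots> \<le> 1 / (2 * real m + 1) * ?r\<^sup>2"
    by (intro mult_right_mono Suc.IH) simp
  also have "\<dots> = (2 * real m + 1) / (2 * real m + 2)\<^sup>2"
    by (simp add: power2_eq_square)
  also have "\<dots> \<le> 1 / (2 * real (Suc m) + 1)"
  proof -
    have "(2 * real m + 1) * (2 * real (Suc m) + 1) \<le> (2 * real m + 2)\<^sup>2"
      by (simp add: power2_eq_square algebra_simps)
    then show ?thesis by (simp add: divide_simps)
  qed
  finally show ?case .
qed

lemma central_binomial_prob_tendsto_0: "central_binomial_prob \<longlonglongrightarrow> 0"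
proof -
  have "(\<lambda>m. (central_binomial_prob m)\<^sup>2) \<longlonglongrightarrow> 0"
  proof (rule tendsto_sandwich[OF _ _ tendsto_const])
    show "(\<lambda>m. 1 / (2 * real m + 1)) \<longlonglongrightarrow> 0"
      by real_asymp
  qed (use central_binomial_prob_sq_le in auto)
  then show ?thesis by (simp add: tendsto_null_power)
qed

lemma Beta_Suc_Suc:
  "Beta (real m + 1) (real m + 1) = 1 / ((2 * real m + 1) * 4 ^ m * central_binomial_prob m)"
proof -
  have "Gamma (real m + 1 + (real m + 1)) = fact (2 * m + 1)"
    using Gamma_fact[of "2 * m + 1", where 'a = real] by (simp add: algebra_simps)
  then have "Beta (real m + 1) (real m + 1) = (fact m)\<^sup>2 / fact (2 * m + 1)"
    using Gamma_fact[of m, where 'a = real] by (simp add: Beta_def power2_eq_square add.commute)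
  also have "fact (2 * m + 1) = (2 * real m + 1) * fact (2 * m)"
    by simp
  finally show ?thesis
    by (simp add: central_binomial_prob_def)
qed

lemma beta_kernel_integral_le:
  assumes "0 \<le> u" "u \<le> v" "v \<le> 1"
    and le: "\<And>t. u \<le> t \<Longrightarrow> t \<le> v \<Longrightarrow> t * (1 - t) \<le> c"
  shows "integral {u..v} (beta_kernel (real m + 1) (real m + 1)) \<le> c ^ m * (v - u)"
proof -
  have "beta_kernel (real m + 1) (real m + 1) t \<le> c ^ m" if "t \<in> {u..v}" for t
  proof -
    have t: "0 \<le> t" "t \<le> 1" "t * (1 - t) \<le> c" "0 \<le> t * (1 - t)" using that assms by auto
    have "beta_kernel (real m + 1) (real m + 1) t \<le> (t * (1 - t)) ^ m"
      using t by (cases "t = 0 \<or> t = 1") (auto simp: beta_kernel_def powr_realpow power_mult_distrib)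
    also have "\<dots> \<le> c ^ m" using t by (intro power_mono) auto
    finally show ?thesis .
  qed
  then have "integral {u..v} (beta_kernel (real m + 1) (real m + 1)) \<le> integral {u..v} (\<lambda>_. c ^ m)"
    using assms by (intro integral_le beta_kernel_integrable) auto
  then show ?thesis using assms by (simp add: mult.commute)
qed

text \<open>The probability in question for \<open>d1 = d2 = 2 (m + 1)\<close>.\<close>

definition diagonal_F_prob :: "real \<Rightarrow> nat \<Rightarrow> real" where
  "diagonal_F_prob \<kappa> m = inc_beta_reg ((real m + 1) * \<kappa> / ((real m + 1) * \<kappa> + real m)) (real m + 1) (real m + 1)"

text \<open>The mass between \<open>1/2\<close> and the threshold is at most the distance \<open>1 / (2 (2 m + 1))\<close> times the peak
  of the density, which leaves half the central binomial probability.\<close>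

lemma diagonal_F_prob_1_tendsto: "diagonal_F_prob 1 \<longlonglongrightarrow> 1 / 2"
proof (rule tendsto_sandwich[OF _ _ tendsto_const])
  have "diagonal_F_prob 1 m \<le> 1 / 2 + central_binomial_prob m / 2" for m
  proof -
    define n where "n = real m + 1"
    define y where "y = n / (n + real m)"
    have y: "1 / 2 \<le> y" "y \<le> 1" by (auto simp: y_def n_def field_simps)
    let ?k = "beta_kernel n n"
    have n: "0 < n" by (simp add: n_def)
    have "integral {0..y} ?k = integral {0..1/2} ?k + integral {1/2..y} ?k"
      using y n
      by (intro Henstock_Kurzweil_Integration.integral_combine[symmetric] beta_kernel_integrable) auto
    then have "diagonal_F_prob 1 m = 1 / 2 + integral {1/2..y} ?k / Beta n n"
      using inc_beta_reg_half[OF n]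
      by (simp add: diagonal_F_prob_def inc_beta_reg_kernel n_def[symmetric] y_def[symmetric] add_divide_distrib)
    also have "integral {1/2..y} ?k / Beta n n \<le> ((1/4) ^ m * (y - 1 / 2)) / Beta n n"
    proof (rule divide_right_mono)
      have "t * (1 - t) \<le> 1 / 4" for t :: real
        using zero_le_power2[of "t - 1/2"] by (simp add: power2_eq_square algebra_simps)
      then show "integral {1/2..y} ?k \<le> (1/4) ^ m * (y - 1 / 2)"
        unfolding n_def using y by (intro beta_kernel_integral_le) auto
    qed (use Beta_pos[OF n n] in simp)
    also have "\<dots> = (y - 1 / 2) * (2 * real m + 1) * central_binomial_prob m"
      unfolding n_def Beta_Suc_Suc by (simp add: power_one_over)
    also have "(y - 1 / 2) * (2 * real m + 1) = 1 / 2"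
      by (simp add: y_def n_def field_simps)
    finally show ?thesis by simp
  qed
  then show "\<forall>\<^sub>F m in sequentially. diagonal_F_prob 1 m \<le> 1 / 2 + central_binomial_prob m / 2"
    by simp
  show "(\<lambda>m. 1 / 2 + central_binomial_prob m / 2) \<longlonglongrightarrow> 1 / 2"
    using tendsto_add[OF tendsto_const tendsto_divide[OF central_binomial_prob_tendsto_0 tendsto_const]]
    by (metis (no_types) add.right_neutral div_0 zero_neq_numeral)
  show "\<forall>\<^sub>F m in sequentially. 1 / 2 \<le> diagonal_F_prob 1 m"
  proof (rule eventually_mono[OF eventually_gt_at_top[of 0]])
    fix m :: nat assume "0 < m"
    then show "1 / 2 \<le> diagonal_F_prob 1 m"
      using inc_beta_reg_mode_gt_half[of "real m + 1" "real m + 1"] by (simp add: diagonal_F_prob_def algebra_simps)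
  qed
qed

text \<open>Below any \<open>z < 1/2\<close> the density is at most \<open>(4 z (1 - z))\<^sup>m\<close> times its peak, which itself grows
  at most linearly. Such a \<open>z\<close> bounds the thresholds eventually, since they tend to
  \<open>\<kappa> / (1 + \<kappa>)\<close>.\<close>

lemma diagonal_F_prob_less_1_tendsto:
  assumes \<kappa>: "0 < \<kappa>" "\<kappa> < 1"
  shows "diagonal_F_prob \<kappa> \<longlonglongrightarrow> 0"
proof -
  define y where "y = (\<lambda>m. (real m + 1) * \<kappa> / ((real m + 1) * \<kappa> + real m))"
  obtain z where z: "\<kappa> / (1 + \<kappa>) < z" "z < 1 / 2"
    using dense[of "\<kappa> / (1 + \<kappa>)" "1 / 2"] \<kappa> by (auto simp: divide_simps)
  have "0 < \<kappa> / (1 + \<kappa>)" using \<kappa> by simp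
  then have z0: "0 < z" using z(1) by (rule less_trans)
  define q where "q = 4 * (z * (1 - z))"
  have q: "0 \<le> q" "q < 1"
  proof -
    show "0 \<le> q" using z z0 by (simp add: q_def)
    have "0 < (1 - 2 * z)\<^sup>2" using z by simp
    then show "q < 1" by (simp add: q_def power2_eq_square algebra_simps)
  qed
  have "y \<longlonglongrightarrow> \<kappa> * inverse (\<kappa> + 1)"
    unfolding y_def using \<kappa> by real_asymp
  also have "\<kappa> * inverse (\<kappa> + 1) = \<kappa> / (1 + \<kappa>)"
    by (simp only: divide_inverse add.commute)
  finally have "y \<longlonglongrightarrow> \<kappa> / (1 + \<kappa>)" .
  then have ev: "\<forall>\<^sub>F m in sequentially. y m < z"
    using z(1) by (rule order_tendstoD)
  have y0: "0 \<le> y m" for m using \<kappa> by (simp add: y_def)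
  have bound: "diagonal_F_prob \<kappa> m \<le> (2 * real m + 1) * q ^ m" if "y m < z" for m
  proof -
    define n where "n = real m + 1"
    have n: "0 < n" by (simp add: n_def)
    have "diagonal_F_prob \<kappa> m = integral {0..y m} (beta_kernel n n) / Beta n n"
      by (simp add: diagonal_F_prob_def inc_beta_reg_kernel n_def y_def)
    also have "\<dots> \<le> ((z * (1 - z)) ^ m * (y m - 0)) / Beta n n"
    proof (rule divide_right_mono)
      have "t * (1 - t) \<le> z * (1 - z)" if "t \<le> y m" for t
      proof -
        have "0 \<le> (z - t) * (1 - t - z)" using that \<open>y m < z\<close> z by simp
        then show ?thesis by (simp add: algebra_simps)
      qed
      then show "integral {0..y m} (beta_kernel n n) \<le> (z * (1 - z)) ^ m * (y m - 0)"
        unfolding n_def using y0 that z z0 by (intro beta_kernel_integral_le) auto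
    qed (use Beta_pos[OF n n] in simp)
    also have "\<dots> = (2 * real m + 1) * q ^ m * (y m * central_binomial_prob m)"
    proof -
      have "q ^ m = 4 ^ m * (z * (1 - z)) ^ m" unfolding q_def by (rule power_mult_distrib)
      then show ?thesis unfolding n_def Beta_Suc_Suc by simp
    qed
    also have "\<dots> \<le> (2 * real m + 1) * q ^ m * 1"
    proof (rule mult_left_mono)
      have "(central_binomial_prob m)\<^sup>2 \<le> 1\<^sup>2"
        using central_binomial_prob_sq_le[of m] by (rule order_trans) simp
      then have "central_binomial_prob m \<le> 1" by (rule power2_le_imp_le) simp
      moreover have "y m \<le> 1" using that z by simp
      ultimately show "y m * central_binomial_prob m \<le> 1"
        using central_binomial_prob_nonneg by (intro mult_le_one)
    qed (use q in auto)
    finally show ?thesis by simp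
  qed
  show ?thesis
  proof (rule tendsto_sandwich[OF _ _ tendsto_const])
    show "\<forall>\<^sub>F m in sequentially. 0 \<le> diagonal_F_prob \<kappa> m"
    proof (rule eventually_mono[OF ev])
      fix m assume "y m < z"
      then show "0 \<le> diagonal_F_prob \<kappa> m"
        using inc_beta_reg_mono[of "real m + 1" "real m + 1" 0 "y m"] y0[of m] z
        by (simp add: diagonal_F_prob_def y_def inc_beta_reg_kernel)
    qed
    show "\<forall>\<^sub>F m in sequentially. diagonal_F_prob \<kappa> m \<le> (2 * real m + 1) * q ^ m"
      by (rule eventually_mono[OF ev bound])
    have "(\<lambda>m. 2 * (real m * q ^ m) + q ^ m) \<longlonglongrightarrow> 2 * 0 + 0"
      using q by (intro tendsto_intros powser_times_n_limit_0 LIMSEQ_power_zero) auto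
    then show "(\<lambda>m. (2 * real m + 1) * q ^ m) \<longlonglongrightarrow> 0"
      by (simp add: algebra_simps)
  qed
qed

section \<open>The infima\<close>

lemma cINF_eq_lower_bound_limit:
  fixes f :: "'i \<Rightarrow> real"
  assumes lb: "\<And>i. i \<in> I \<Longrightarrow> c \<le> f i"
    and s: "\<And>n. s n \<in> I" and lim: "(\<lambda>n. f (s n)) \<longlonglongrightarrow> c"
  shows "(INF i\<in>I. f i) = c"
proof (rule antisym)
  have "(INF i\<in>I. f i) \<le> f (s n)" for n
    using lb s by (intro cINF_lower bdd_belowI2)
  then show "(INF i\<in>I. f i) \<le> c"
    by (intro LIMSEQ_le_const[OF lim]) auto
  show "c \<le> (INF i\<in>I. f i)"
    using s lb by (intro cINF_greatest) auto
qed

theorem theorem1p1: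
  fixes M :: "int \<Rightarrow> int \<Rightarrow> 'a measure"
    and X :: "int \<Rightarrow> int \<Rightarrow> 'a \<Rightarrow> real"
    and \<kappa> :: real
  assumes F: "\<And>d1 d2. d1 \<ge> 1 \<Longrightarrow> d2 > 2 \<Longrightarrow> F_random_variable (M d1 d2) d1 d2 (X d1 d2)"
    and \<kappa>: "\<kappa> > 0"
  shows
    "(\<kappa> < 1 \<longrightarrow>
        (INF (d1, d2) \<in> {(d1, d2). d1 \<ge> 1 \<and> d2 > 2}.
           \<P>(\<omega> in M d1 d2. X d1 d2 \<omega> \<le> \<kappa> * prob_space.expectation (M d1 d2) (X d1 d2))) = 0) \<and>
     (\<kappa> = 1 \<longrightarrow>
        (INF (d1, d2) \<in> {(d1, d2). d1 \<ge> 1 \<and> d2 > 2}.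
           \<P>(\<omega> in M d1 d2. X d1 d2 \<omega> \<le> \<kappa> * prob_space.expectation (M d1 d2) (X d1 d2))) = 1 / 2) \<and>
     (\<kappa> > 1 \<longrightarrow>
        (INF (d1, d2) \<in> {(d1, d2). d1 \<ge> 1 \<and> d2 > 2}.
           \<P>(\<omega> in M d1 d2. X d1 d2 \<omega> \<le> \<kappa> * prob_space.expectation (M d1 d2) (X d1 d2))) \<ge> 1 / 2) \<and>
     (\<forall>d1 d2. d1 \<ge> 1 \<longrightarrow> d2 > 2 \<longrightarrow>
        \<P>(\<omega> in M d1 d2. X d1 d2 \<omega> \<le> prob_space.expectation (M d1 d2) (X d1 d2)) > 1 / 2) \<and>
     (INF (d1, d2) \<in> {(d1, d2). d1 \<ge> 1 \<and> d2 > 2}.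
        \<P>(\<omega> in M d1 d2. X d1 d2 \<omega> \<le> prob_space.expectation (M d1 d2) (X d1 d2))) = 1 / 2"
proof -
  let ?I = "{(d1, d2). d1 \<ge> 1 \<and> d2 > 2} :: (int \<times> int) set"
  define P where "P = (\<lambda>k d1 d2.
    \<P>(\<omega> in M d1 d2. X d1 d2 \<omega> \<le> k * prob_space.expectation (M d1 d2) (X d1 d2)))"
  have P: "P k d1 d2 = inc_beta_reg (d1 / 2 * k / (d1 / 2 * k + d2 / 2 - 1)) (d1 / 2) (d2 / 2)"
    if "1 \<le> d1" "2 < d2" "0 < k" for k d1 d2
    unfolding P_def
    by (rule F_random_variable_prob_le_mult_expectation[OF F[OF that(1,2)] that refl refl])
  have gt: "1 / 2 < P 1 d1 d2" if "1 \<le> d1" "2 < d2" for d1 d2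
    using that P[OF that, of 1] inc_beta_reg_mode_gt_half[of "d1 / 2" "d2 / 2"] by simp
  have mono: "P 1 d1 d2 \<le> P k d1 d2" if "1 \<le> d1" "2 < d2" "1 \<le> k" for k d1 d2
  proof -
    have d: "0 < d1 / 2" "0 < d2 / 2 - (1::real)" using that by auto
    show ?thesis
      unfolding P[OF that(1,2) zero_less_one] P[OF that(1,2) less_le_trans[OF zero_less_one that(3)]]
      using inc_beta_reg_mono_threshold[OF d that(3)] by simp
  qed
  \<comment> \<open>The diagonal starts at \<open>d1 = d2 = 4\<close>, as \<open>d2 > 2\<close> excludes the index \<open>m = 0\<close> of
    \<open>diagonal_F_prob\<close>.\<close>
  define s where "s = (\<lambda>m::nat. (2 * int m + 4, 2 * int m + 4))"
  have s: "s m \<in> ?I" for m by (auto simp: s_def)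
  have Ps: "(case s m of (d1, d2) \<Rightarrow> P k d1 d2) = diagonal_F_prob k (Suc m)" if "0 < k" for k m
  proof -
    have half: "real_of_int (2 * int m + 4) / 2 = real (Suc m) + 1" by simp
    show ?thesis
      using P[of "2 * int m + 4" "2 * int m + 4" k] that
      unfolding s_def diagonal_F_prob_def half prod.case by (simp add: add_ac)
  qed
  have inf: "(INF (d1, d2) \<in> ?I. P k d1 d2) = c"
    if "0 < k" "\<And>d1 d2. 1 \<le> d1 \<Longrightarrow> 2 < d2 \<Longrightarrow> c \<le> P k d1 d2" "diagonal_F_prob k \<longlonglongrightarrow> c" for k c
  proof (rule cINF_eq_lower_bound_limit[OF _ s])
    show "(\<lambda>m. case s m of (d1, d2) \<Rightarrow> P k d1 d2) \<longlonglongrightarrow> c"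
      unfolding Ps[OF that(1)] by (rule LIMSEQ_Suc[OF that(3)])
  qed (use that(2) in auto)
  have inf1: "(INF (d1, d2) \<in> ?I. P 1 d1 d2) = 1 / 2"
    using gt by (intro inf diagonal_F_prob_1_tendsto) (auto intro: less_imp_le)
  have inf0: "(INF (d1, d2) \<in> ?I. P \<kappa> d1 d2) = 0" if "\<kappa> < 1"
    using that \<kappa> by (intro inf diagonal_F_prob_less_1_tendsto) (auto simp: P_def)
  have inf2: "1 / 2 \<le> (INF (d1, d2) \<in> ?I. P \<kappa> d1 d2)" if "1 < \<kappa>"
  proof (rule cINF_greatest)
    show "?I \<noteq> {}" using s by blast
    show "1 / 2 \<le> (case i of (d1, d2) \<Rightarrow> P \<kappa> d1 d2)" if "i \<in> ?I" for i
      using that \<open>1 < \<kappa>\<close> gt[of "fst i" "snd i"] mono[of "fst i" "snd i" \<kappa>]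
      by (auto split: prod.splits)
  qed
  show ?thesis
  proof (intro conjI impI allI)
    assume "\<kappa> < 1"
    from inf0[OF this] show "(INF (d1, d2) \<in> ?I. \<P>(\<omega> in M d1 d2.
        X d1 d2 \<omega> \<le> \<kappa> * prob_space.expectation (M d1 d2) (X d1 d2))) = 0"
      unfolding P_def .
  next
    assume "\<kappa> = 1"
    with inf1 show "(INF (d1, d2) \<in> ?I. \<P>(\<omega> in M d1 d2.
        X d1 d2 \<omega> \<le> \<kappa> * prob_space.expectation (M d1 d2) (X d1 d2))) = 1 / 2"
      unfolding P_def by (simp only:)
  next
    assume "1 < \<kappa>"
    from inf2[OF this] show "1 / 2 \<le> (INF (d1, d2) \<in> ?I. \<P>(\<omega> in M d1 d2.
        X d1 d2 \<omega> \<le> \<kappa> * prob_space.expectation (M d1 d2) (X d1 d2)))"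
      unfolding P_def .
  next
    fix d1 d2 :: int
    assume "1 \<le> d1" "2 < d2"
    from gt[OF this] show "1 / 2 < \<P>(\<omega> in M d1 d2.
        X d1 d2 \<omega> \<le> prob_space.expectation (M d1 d2) (X d1 d2))"
      unfolding P_def mult_1 .
  next
    from inf1 show "(INF (d1, d2) \<in> ?I. \<P>(\<omega> in M d1 d2.
        X d1 d2 \<omega> \<le> prob_space.expectation (M d1 d2) (X d1 d2))) = 1 / 2"
      unfolding P_def mult_1 .
  qed
qed

end
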